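(* Let $\mu$ be a finite positive measure on the unit disk $\mathbb{D}$ that is absolutely continuous with respect to the Lebesgue measure on $\mathbb{D}$ and is a doubling measure. Then $\mu$ is a $\mathcal{D}$-Carleson measure; that is, there is a constant $C$ such that $\int_{\mathbb{D}}|f|^2\,d\mu\le C\|f\|_{\mathcal{D}}^2$ for all $f\in\mathcal{D}$.
   Context: $\mathbb{D}$ is the open unit disk in $\mathbb{C}$ and $dA$ the Lebesgue area measure. The Dirichlet space $\mathcal{D}$ consists of the analytic functions $f$ on $\mathbb{D}$ with $\|f\|_{\mathcal{D}}^2=|f(0)|^2+\frac1\pi\int_{\mathbb{D}}|f'(z)|^2\,dA(z)<\infty$. A measure $\mu$ on $\mathbb{D}$ is called a doubling measure if there exists a constant $C'$ such that $\mu(B(z,2r))\le C'\mu(B(z,r))$ for all $z\in\mathbb{D}$ and $r>0$, where $B(z,r)=\{w\in\mathbb{D}:|z-w|<r\}$. *)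

theory Defs
  imports "HOL-Complex_Analysis.Complex_Analysis"
begin

abbreviation unit_disk :: "complex set" where
  "unit_disk \<equiv> ball 0 1"

text \<open>
  Integrals of nonnegative functions are taken in \<^typ>\<open>ennreal\<close>, so that the norm is
  defined (possibly infinite) for every analytic function, and so that an infinite
  integral cannot satisfy the Carleson inequality.
\<close>

definition dirichlet_norm_sq :: "(complex \<Rightarrow> complex) \<Rightarrow> ennreal" where
  "dirichlet_norm_sq f =
     ennreal ((cmod (f 0))\<^sup>2) +
     ennreal (1 / pi) * (\<integral>\<^sup>+ z \<in> unit_disk. ennreal ((cmod (deriv f z))\<^sup>2) \<partial>lborel)"

definition dirichlet_space :: "(complex \<Rightarrow> complex) set" where
  "dirichlet_space = {f. f holomorphic_on unit_disk \<and> dirichlet_norm_sq f < \<infinity>}"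

definition disk_lborel :: "complex measure" where
  "disk_lborel = restrict_space lborel unit_disk"

definition disk_ball :: "complex \<Rightarrow> real \<Rightarrow> complex set" where
  "disk_ball z r = {w \<in> unit_disk. cmod (z - w) < r}"

definition doubling_measure :: "complex measure \<Rightarrow> bool" where
  "doubling_measure \<mu> \<longleftrightarrow>
     (\<exists>C'::real. \<forall>z\<in>unit_disk. \<forall>r>0.
        emeasure \<mu> (disk_ball z (2 * r)) \<le> ennreal C' * emeasure \<mu> (disk_ball z r))"

definition dirichlet_carleson_measure :: "complex measure \<Rightarrow> bool" where
  "dirichlet_carleson_measure \<mu> \<longleftrightarrow>
     (\<exists>C::real. \<forall>f\<in>dirichlet_space.
        (\<integral>\<^sup>+ z. ennreal ((cmod (f z))\<^sup>2) \<partial>\<mu>) \<le> ennreal C * dirichlet_norm_sq f)"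

end

theory Submission
  imports Defs
begin

text \<open>
  Doubling forces geometric decay of the mass of small balls: \<open>\<mu>(B(z, 4\<^sup>-\<^sup>k)) \<le> \<theta>\<^sup>k \<mu>(\<D>)\<close> with
  \<open>\<theta> < 1\<close>, uniformly in \<open>z\<close>. The kernel of the Dirichlet space, \<open>1 + \<Sum> x\<^sup>n / n\<close> at
  \<open>x = z * cnj w\<close>, has at most a logarithmic singularity in \<open>\<bar>1 - x\<bar> \<ge> \<bar>z - w\<bar>\<close>, and so do its
  partial sums, uniformly. Hence \<open>\<integral> \<bar>K(z, w)\<bar> d\<mu>(w)\<close> is bounded uniformly in \<open>z\<close> and in the
  truncation, and Schur's test, in its \<open>T T*\<close> form, gives the Carleson inequality for polynomials
  in terms of \<open>\<bar>a\<^sub>0\<bar>\<^sup>2 + \<Sum> n \<bar>a\<^sub>n\<bar>\<^sup>2\<close>. Orthogonality of the monomials on disks bounds this sum by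
  the Dirichlet norm, and Fatou's lemma passes from Taylor polynomials to \<open>f\<close>.
\<close>

subsection \<open>Partial sums of the logarithmic series\<close>

text \<open>
  Abel summation: with the boundary term \<open>x ^ Suc N / Suc N\<close> included, each step changes the
  left-hand side by \<open>x ^ (N + 2) * (1 / (N + 2) - 1 / (N + 1))\<close>, so the bound telescopes.
\<close>

lemma abel_log_tail:
  fixes x :: complex
  assumes "cmod x \<le> 1" "M \<le> N"
  shows "cmod ((1 - x) * (\<Sum>n=Suc M..N. x ^ n / of_nat n) + x ^ Suc N / of_nat (Suc N))
           \<le> 2 / real (Suc M) - 1 / real (Suc N)"
  using assms(2)
proof (induction N rule: dec_induct)
  case base
  have "cmod (x ^ Suc M) \<le> 1"
    using assms(1) by (simp only: norm_power power_le_one norm_ge_zero)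
  then show ?case
    by (simp add: norm_divide divide_right_mono del: of_nat_Suc power_Suc)
next
  case (step N)
  let ?a = "1 / real (Suc N)" and ?b = "1 / real (Suc (Suc N))"
  have ab: "?b \<le> ?a" by (simp add: field_simps)
  have "(1 - x) * (\<Sum>n=Suc M..Suc N. x ^ n / of_nat n) + x ^ Suc (Suc N) / of_nat (Suc (Suc N))
     = ((1 - x) * (\<Sum>n=Suc M..N. x ^ n / of_nat n) + x ^ Suc N / of_nat (Suc N))
       + x ^ Suc (Suc N) * of_real (?b - ?a)"
    using step.hyps by (simp add: divide_inverse algebra_simps)
  also have "cmod \<dots> \<le> (2 / real (Suc M) - ?a) + 1 * (?a - ?b)"
  proof (intro norm_triangle_mono step.IH)
    have "cmod (x ^ Suc (Suc N)) \<le> 1"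
      using assms(1) by (simp only: norm_power power_le_one norm_ge_zero)
    then show "cmod (x ^ Suc (Suc N) * of_real (?b - ?a)) \<le> 1 * (?a - ?b)"
      unfolding norm_mult norm_of_real using ab by (intro mult_mono) linarith+
  qed
  finally show ?case by simp
qed

text \<open>Each block \<open>{4^k<..4^Suc k}\<close> has \<open>3 * 4^k\<close> terms, none above
  \<open>1 / 4^k\<close>, so it adds at most 3. Base 4 matches the radii \<open>1 / 4^k\<close> at
  which the measure of balls is controlled later.\<close>

lemma harmonic_dyadic_bound: "(\<Sum>n=1..4^k. 1 / real n) \<le> 1 + 3 * real k"
proof (induction k)
  case (Suc k)
  have "{1..(4::nat)^Suc k} = {1..4^k} \<union> {4^k<..4^Suc k}" by auto
  then have "(\<Sum>n=1..4^Suc k. 1 / real n)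
      = (\<Sum>n=1..4^k. 1 / real n) + (\<Sum>n\<in>{4^k<..4^Suc k}. 1 / real n)"
    by (simp only:) (subst sum.union_disjoint, auto)
  also have "(\<Sum>n\<in>{(4::nat)^k<..4^Suc k}. 1 / real n) \<le> of_nat (card {(4::nat)^k<..4^Suc k}) * (1 / 4 ^ k)"
  proof (rule sum_bounded_above)
    fix n :: nat assume "n \<in> {4^k<..4^Suc k}"
    then have "(4::real) ^ k \<le> real n"
      by (metis greaterThanAtMost_iff less_imp_le of_nat_le_iff of_nat_numeral of_nat_power)
    then show "1 / real n \<le> 1 / 4 ^ k" by (intro divide_left_mono mult_pos_pos) (auto intro: less_le_trans[of _ "4^k"])
  qed
  also have "of_nat (card {(4::nat)^k<..4^Suc k}) * (1 / 4 ^ k) = (3::real)"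
    by simp
  finally show ?case using Suc by simp
qed simp

text \<open>The sum is cut at index \<open>4^k\<close>, about \<open>1 / cmod (1 - x)\<close>. Below
  the cut there is no useful cancellation and the harmonic bound is logarithmic; beyond it, Abel
  summation leaves at most 2. The bound does not depend on \<open>N\<close>, as a uniform kernel
  estimate requires.\<close>

lemma log_partial_sum_bound:
  fixes x :: complex
  assumes x: "cmod x \<le> 1" and k: "1 \<le> 4 ^ k * cmod (1 - x)"
  shows "cmod (\<Sum>n=1..N. x ^ n / of_nat n) \<le> 3 + 3 * real k"
proof -
  have head: "cmod (\<Sum>n=1..K. x ^ n / of_nat n) \<le> 1 + 3 * real k" if "K \<le> 4 ^ k" for K
  proof -
    have "cmod (\<Sum>n=1..K. x ^ n / of_nat n) \<le> (\<Sum>n=1..K. 1 / real n)"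
      using x by (intro order.trans[OF norm_sum] sum_mono)
        (auto simp: norm_divide norm_power power_le_one divide_right_mono)
    also have "\<dots> \<le> (\<Sum>n=1..4^k. 1 / real n)"
      using that by (intro sum_mono2) auto
    finally show ?thesis using harmonic_dyadic_bound[of k] by linarith
  qed
  show ?thesis
  proof (cases "N \<le> 4 ^ k")
    case True
    then show ?thesis using head[of N] by linarith
  next
    case False
    define M :: nat where "M = 4 ^ k"
    have MN: "M \<le> N" using False by (simp add: M_def)
    let ?T = "\<Sum>n=Suc M..N. x ^ n / of_nat n" and ?e = "x ^ Suc N / of_nat (Suc N)"
    have "cmod ?e \<le> 1 / real (Suc N)"
    proof -
      have "cmod (x ^ Suc N) \<le> 1"
        using x by (simp only: norm_power power_le_one norm_ge_zero)
      then show ?thesis by (simp add: norm_divide divide_right_mono del: of_nat_Suc power_Suc)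
    qed
    moreover have "cmod ((1 - x) * ?T) \<le> cmod ((1 - x) * ?T + ?e) + cmod ?e"
      by (metis add_diff_cancel_right' norm_triangle_ineq4)
    \<comment> \<open>The boundary term costs at most \<open>1 / real (Suc N)\<close>, exactly the
      amount subtracted in \<open>abel_log_tail\<close>.\<close>
    ultimately have "cmod (1 - x) * cmod ?T \<le> 2 / real (Suc M)"
      using abel_log_tail[OF x MN] by (simp only: norm_mult)
    also have "\<dots> \<le> 2 / real M" by (intro divide_left_mono) (auto simp: M_def intro!: mult_pos_pos add_pos_pos)
    also have "\<dots> \<le> 2 * cmod (1 - x)"
      using k by (simp add: M_def field_simps)
    finally have "cmod (1 - x) * cmod ?T \<le> cmod (1 - x) * 2" by simp
    moreover have "0 < cmod (1 - x)" using k by (auto simp: zero_less_norm_iff)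
    ultimately have "cmod ?T \<le> 2" by simp
    moreover have "(\<Sum>n=1..N. x ^ n / of_nat n) = (\<Sum>n=1..M. x ^ n / of_nat n) + ?T"
    proof -
      have "{1..N} = {1..M} \<union> {Suc M..N}" using MN by auto
      then show ?thesis by (simp only:) (subst sum.union_disjoint, auto)
    qed
    moreover have "cmod (\<Sum>n=1..M. x ^ n / of_nat n) \<le> 1 + 3 * real k"
      by (rule head) (simp add: M_def)
    ultimately show ?thesis
      by (smt (verit) norm_triangle_ineq)
  qed
qed

text \<open>The two squares differ by (1 - |z|^2)(1 - |w|^2). This turns the singularity of the
  kernel at \<open>z * cnj w = 1\<close> into one in the distance of \<open>z\<close> and
  \<open>w\<close>, which the ball estimates can measure.\<close>

lemma cmod_diff_le_one_minus_mult_cnj: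
  assumes "cmod z \<le> 1" "cmod w \<le> 1"
  shows "cmod (z - w) \<le> cmod (1 - z * cnj w)"
proof -
  have "(cmod (1 - z * cnj w))\<^sup>2 = (cmod (z - w))\<^sup>2 + (1 - (cmod z)\<^sup>2) * (1 - (cmod w)\<^sup>2)"
    unfolding cmod_power2 by (simp add: power2_eq_square algebra_simps)
  moreover have "0 \<le> (1 - (cmod z)\<^sup>2) * (1 - (cmod w)\<^sup>2)"
    using assms by (intro mult_nonneg_nonneg) (auto simp: power_le_one)
  ultimately have "(cmod (z - w))\<^sup>2 \<le> (cmod (1 - z * cnj w))\<^sup>2" by linarith
  then show ?thesis by (rule power2_le_imp_le) simp
qed

subsection \<open>Decay of doubling measures\<close>

lemma disk_ball_eq: "disk_ball z r = unit_disk \<inter> ball z r"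
  by (auto simp: disk_ball_def dist_norm)

text \<open>Shrinking the radius by 4 loses a fixed proportion of the mass. The resulting geometric
  rate makes the masses over all scales summable, which is what integrating a logarithmic
  singularity needs.\<close>

lemma doubling_measure_ball_decay:
  assumes sets: "sets \<mu> = sets disk_lborel" and fin: "finite_measure \<mu>"
    and dbl: "doubling_measure \<mu>"
  obtains \<theta> :: real where "0 \<le> \<theta>" "\<theta> < 1"
    "\<And>z k. z \<in> unit_disk \<Longrightarrow>
       measure \<mu> (disk_ball z (1 / 4 ^ k)) \<le> \<theta> ^ k * measure \<mu> unit_disk"
proof -
  interpret finite_measure \<mu> by (rule fin)
  have meas: "disk_ball z r \<in> sets \<mu>" for z r
    unfolding disk_ball_eq sets disk_lborel_def by (auto simp: sets_restrict_space)
  obtain C0 :: real where C0: "\<And>z r. z \<in> unit_disk \<Longrightarrow> r > 0 \<Longrightarrow>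
      emeasure \<mu> (disk_ball z (2 * r)) \<le> ennreal C0 * emeasure \<mu> (disk_ball z r)"
    using dbl unfolding doubling_measure_def by blast
  \<comment> \<open>The given constant may be negative or below 1; raising it to at least 1 permits
    passing from \<open>ennreal\<close> to \<open>real\<close> and dividing by
    \<open>C\<^sup>2\<close>.\<close>
  define C where "C = max C0 1"
  have C1: "1 \<le> C" by (simp add: C_def)
  have C: "measure \<mu> (disk_ball z (2 * r)) \<le> C * measure \<mu> (disk_ball z r)"
    if "z \<in> unit_disk" "r > 0" for z r
  proof -
    have "emeasure \<mu> (disk_ball z (2 * r)) \<le> ennreal C * emeasure \<mu> (disk_ball z r)"
      using C0[OF that] by (rule order.trans) (auto intro!: mult_right_mono ennreal_leI simp: C_def)
    then have "ennreal (measure \<mu> (disk_ball z (2 * r))) \<le> ennreal (C * measure \<mu> (disk_ball z r))"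
      using C1 by (simp add: emeasure_eq_measure ennreal_mult)
    then show ?thesis using C1 by (subst (asm) ennreal_le_iff) auto
  qed
  \<comment> \<open>The disjoint balls B(z, r) and B(w, r) inside B(z, 4r) carry together at least
    \<open>1 + 1 / C\<^sup>2\<close> times the mass of the first one.\<close>
  define \<theta> where "\<theta> = 1 / (1 + 1 / C\<^sup>2)"
  have th: "0 \<le> \<theta>" "\<theta> < 1" using C1 by (auto simp: \<theta>_def divide_simps add_pos_nonneg)
  \<comment> \<open>The ball \<open>B(z, 4r)\<close> contains a ball \<open>B(w, r)\<close> that is disjoint from \<open>B(z, r)\<close> but,
    by doubling, has comparable mass; \<open>w\<close> is \<open>z\<close> moved by \<open>2r\<close> towards the centre.\<close>
  have step: "measure \<mu> (disk_ball z r) \<le> \<theta> * measure \<mu> (disk_ball z (4 * r))"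
    if z: "z \<in> unit_disk" and r: "0 < r" "r \<le> 1 / 4" for z r
  proof -
    obtain w where w: "w \<in> unit_disk" "cmod (z - w) = 2 * r"
    proof (cases "z = 0")
      case True
      then show ?thesis using r by (intro that[of "of_real (2 * r)"]) (auto simp: norm_mult)
    next
      case False
      \<comment> \<open>The move may overshoot the centre; still |w| = | |z| - 2r | < 1, because |z|
        < 1 and 2r is at most 1/2. At \<open>z = 0\<close> there is no direction to follow, hence
        the separate case.\<close>
      define w where "w = z - of_real (2 * r / cmod z) * z"
      have "w = of_real (1 - 2 * r / cmod z) * z" by (simp add: w_def algebra_simps)
      then have "cmod w = \<bar>1 - 2 * r / cmod z\<bar> * cmod z" by (simp only: norm_mult norm_of_real)
      also have "\<dots> = \<bar>(1 - 2 * r / cmod z) * cmod z\<bar>" by (simp add: abs_mult)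
      also have "(1 - 2 * r / cmod z) * cmod z = cmod z - 2 * r" using False by (simp add: field_simps)
      finally have "cmod w < 1" using z r norm_ge_zero[of z] by (simp del: norm_ge_zero)
      moreover have "cmod (z - w) = 2 * r"
        using False r by (simp add: w_def norm_mult norm_divide)
      ultimately show ?thesis by (intro that[of w]) auto
    qed
    \<comment> \<open>Radius 3r would suffice; 4r is reached from r by exactly two doublings, whence
      the factor \<open>C\<^sup>2\<close>.\<close>
    have "disk_ball z r \<subseteq> disk_ball w (4 * r)"
    proof
      fix v assume "v \<in> disk_ball z r"
      moreover have "cmod (w - v) \<le> cmod (z - w) + cmod (z - v)"
        by (metis dist_norm dist_triangle3)
      ultimately show "v \<in> disk_ball w (4 * r)" using w r by (auto simp: disk_ball_def)
    qed
    then have "measure \<mu> (disk_ball z r) \<le> measure \<mu> (disk_ball w (2 * (2 * r)))"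
      by (intro finite_measure_mono meas) simp
    also have "\<dots> \<le> C * (C * measure \<mu> (disk_ball w r))"
      using C[OF w(1), of "2 * r"] C[OF w(1), of r] r C1
      by (meson order.trans mult_left_mono order_less_imp_le zero_less_mult_iff zero_less_numeral zero_less_one order.strict_trans2)
    finally have "measure \<mu> (disk_ball z r) / C\<^sup>2 \<le> measure \<mu> (disk_ball w r)"
      using C1 by (simp add: field_simps power2_eq_square)
    moreover have "measure \<mu> (disk_ball z r) + measure \<mu> (disk_ball w r)
        = measure \<mu> (disk_ball z r \<union> disk_ball w r)"
    proof (rule finite_measure_Union[symmetric, OF meas meas])
      have "cmod (z - w) \<le> cmod (z - v) + cmod (w - v)" for v
        by (metis dist_norm dist_triangle2)
      then show "disk_ball z r \<inter> disk_ball w r = {}"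
        using w(2) by (auto simp: disk_ball_def) (smt (verit))
    qed
    moreover have "\<dots> \<le> measure \<mu> (disk_ball z (4 * r))"
    proof (intro finite_measure_mono meas)
      have "cmod (z - v) \<le> cmod (z - w) + cmod (w - v)" for v
        by (metis dist_norm dist_triangle)
      then show "disk_ball z r \<union> disk_ball w r \<subseteq> disk_ball z (4 * r)"
        using w(2) r(1) by (auto simp: disk_ball_def) (smt (verit))
    qed
    ultimately have "measure \<mu> (disk_ball z r) * (1 + 1 / C\<^sup>2) \<le> measure \<mu> (disk_ball z (4 * r))"
      by (simp add: algebra_simps)
    moreover have "0 < 1 + 1 / C\<^sup>2" by (simp add: add_pos_nonneg)
    ultimately show ?thesis by (simp add: \<theta>_def pos_le_divide_eq)
  qed
  have "measure \<mu> (disk_ball z (1 / 4 ^ k)) \<le> \<theta> ^ k * measure \<mu> unit_disk" if z: "z \<in> unit_disk" for z k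
  proof (induction k)
    case 0
    have "unit_disk \<in> sets \<mu>" unfolding sets disk_lborel_def by (simp add: sets_restrict_space_iff)
    then show ?case by (auto intro!: finite_measure_mono simp: disk_ball_def)
  next
    case (Suc k)
    have "measure \<mu> (disk_ball z (1 / 4 ^ Suc k)) \<le> \<theta> * measure \<mu> (disk_ball z (1 / 4 ^ k))"
      using step[OF z, of "1 / 4 ^ Suc k"] by (simp add: field_simps)
    also have "\<dots> \<le> \<theta> * (\<theta> ^ k * measure \<mu> unit_disk)"
      using Suc th by (intro mult_left_mono) auto
    finally show ?case by simp
  qed
  with th that show ?thesis by blast
qed

subsection \<open>Schur test\<close>

lemma borel_measurable_cnj [measurable]: "cnj \<in> borel_measurable borel"
  by (intro borel_measurable_continuous_onI continuous_intros)

text \<open>Let T send coefficients, normed by the sum of \<open>(cmod (a n))\<^sup>2 / v n\<close>,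
  to the function with expansion in \<open>e n\<close> in L^2. The kernel in the hypothesis is that
  of T T*. Its modulus is symmetric, so a bound on the integral in one variable serves for both
  sides of Schur's test: the norm of T T* is at most \<open>C\<close>, hence so is the squared norm
  of T.\<close>

lemma finite_rank_schur_test:
  fixes e :: "nat \<Rightarrow> 'a \<Rightarrow> complex" and a :: "nat \<Rightarrow> complex" and v :: "nat \<Rightarrow> real"
  assumes fin: "finite_measure M" and I: "finite I"
    and e_meas [measurable]: "\<And>n. e n \<in> borel_measurable M"
    and e_bound: "\<And>n x. x \<in> space M \<Longrightarrow> cmod (e n x) \<le> 1"
    and v: "\<And>n. n \<in> I \<Longrightarrow> 0 < v n"
    and kernel: "\<And>x. x \<in> space M \<Longrightarrow>
      (\<integral>\<^sup>+ y. ennreal (cmod (\<Sum>n\<in>I. of_real (v n) * e n x * cnj (e n y))) \<partial>M) \<le> ennreal C"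
    and C: "0 < C"
  shows "(\<integral>\<^sup>+ x. ennreal ((cmod (\<Sum>n\<in>I. a n * e n x))\<^sup>2) \<partial>M)
           \<le> ennreal (C * (\<Sum>n\<in>I. (cmod (a n))\<^sup>2 / v n))"
proof -
  interpret finite_measure M by (rule fin)
  interpret P: pair_sigma_finite M M ..
  define p where "p x = (\<Sum>n\<in>I. a n * e n x)" for x
  define K where "K x y = (\<Sum>n\<in>I. of_real (v n) * e n x * cnj (e n y))" for x y
  define B where "B = (\<Sum>n\<in>I. cmod (a n))"
  have p_meas [measurable]: "p \<in> borel_measurable M" unfolding p_def by measurable
  have p_bound: "cmod (p x) \<le> B" if "x \<in> space M" for x
    unfolding p_def B_def using e_bound[OF that]
    by (intro order.trans[OF norm_sum] sum_mono) (simp add: norm_mult mult_left_le)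
  have B: "0 \<le> B" by (simp add: B_def sum_nonneg)
  have pe_int: "integrable M (\<lambda>x. e n x * cnj (p x))" for n
  proof (rule integrable_const_bound[where B = B])
    show "AE x in M. cmod (e n x * cnj (p x)) \<le> B"
      using p_bound e_bound B by (intro AE_I2) (smt (verit) norm_mult complex_mod_cnj mult_left_le_one_le norm_ge_zero)
  qed measurable
  \<comment> \<open>Up to conjugation and the weights \<open>v n\<close>, these are the coefficients
    of T* applied to \<open>p\<close>.\<close>
  define c where "c n = (\<integral>x. e n x * cnj (p x) \<partial>M)" for n
  define X where "X = (\<integral>x. (cmod (p x))\<^sup>2 \<partial>M)"
  have p2_int: "integrable M (\<lambda>x. (cmod (p x))\<^sup>2)"
    using p_bound B by (intro integrable_const_bound[where B = "B\<^sup>2"] AE_I2) (auto intro: power_mono)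
  have X_nn: "(\<integral>\<^sup>+ x. ennreal ((cmod (p x))\<^sup>2) \<partial>M) = ennreal X"
    unfolding X_def by (rule nn_integral_eq_integral[OF p2_int]) simp
  have X0: "0 \<le> X" by (simp add: X_def)
  have X_eq: "complex_of_real X = (\<Sum>n\<in>I. a n * c n)"
  proof -
    have "complex_of_real X = (\<integral>x. complex_of_real ((cmod (p x))\<^sup>2) \<partial>M)"
      unfolding X_def by (rule integral_complex_of_real[symmetric])
    also have "\<dots> = (\<integral>x. (\<Sum>n\<in>I. a n * (e n x * cnj (p x))) \<partial>M)"
      unfolding complex_norm_square p_def by (simp add: sum_distrib_right mult.assoc)
    also have "\<dots> = (\<Sum>n\<in>I. a n * c n)"
      unfolding c_def using pe_int by (subst Bochner_Integration.integral_sum) simp_all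
    finally show ?thesis .
  qed
  \<comment> \<open>\<open>S\<close> is the squared norm of the dual element: expanded as a double integral against the
    kernel it is at most \<open>C * X\<close>, while duality gives \<open>X\<^sup>2 \<le> S * (\<Sum>n\<in>I. (cmod (a n))\<^sup>2 / v n)\<close>.\<close>
  define S where "S = (\<Sum>n\<in>I. v n * (cmod (c n))\<^sup>2)"
  have S0: "0 \<le> S" unfolding S_def using v by (intro sum_nonneg) (simp add: less_imp_le)
  have K_sym: "cmod (K x y) = cmod (K y x)" for x y
  proof -
    have "K x y = cnj (K y x)" unfolding K_def by (simp add: mult_ac)
    then show ?thesis by simp
  qed
  have K_meas [measurable]: "case_prod K \<in> borel_measurable (M \<Otimes>\<^sub>M M)"
    unfolding K_def by measurable
  have Kx_meas [measurable]: "K x \<in> borel_measurable M" for x unfolding K_def by measurable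
  have K_meas_left [measurable]: "(\<lambda>x. K x y) \<in> borel_measurable M" for y
    unfolding K_def by measurable
  have S_le: "S \<le> C * X"
  proof -
    define D where "D = (\<integral>\<^sup>+ x. (\<integral>\<^sup>+ y. ennreal ((cmod (p x))\<^sup>2 / 2) * ennreal (cmod (K x y)) \<partial>M) \<partial>M)"
    have D_le: "D \<le> ennreal (C * X / 2)"
    proof -
      have "D \<le> (\<integral>\<^sup>+ x. ennreal (C / 2) * ennreal ((cmod (p x))\<^sup>2) \<partial>M)"
        unfolding D_def
      proof (rule nn_integral_mono)
        fix x assume "x \<in> space M"
        then have "(\<integral>\<^sup>+ y. ennreal ((cmod (p x))\<^sup>2 / 2) * ennreal (cmod (K x y)) \<partial>M)
            \<le> ennreal ((cmod (p x))\<^sup>2 / 2) * ennreal C"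
          using kernel[of x] by (subst nn_integral_cmult) (auto simp: K_def intro!: mult_left_mono)
        also have "\<dots> = ennreal (C / 2) * ennreal ((cmod (p x))\<^sup>2)"
          using C by (simp add: ennreal_mult[symmetric] mult_ac)
        finally show "(\<integral>\<^sup>+ y. ennreal ((cmod (p x))\<^sup>2 / 2) * ennreal (cmod (K x y)) \<partial>M)
            \<le> ennreal (C / 2) * ennreal ((cmod (p x))\<^sup>2)" .
      qed
      also have "\<dots> = ennreal (C * X / 2)"
        using C X0 by (subst nn_integral_cmult) (auto simp: X_nn ennreal_mult[symmetric])
      finally show ?thesis .
    qed
    have inner_int: "integrable M (\<lambda>x. cnj (p x) * K x y)" for y
    proof -
      have "(\<lambda>x. cnj (p x) * K x y) = (\<lambda>x. \<Sum>n\<in>I. (of_real (v n) * cnj (e n y)) * (e n x * cnj (p x)))"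
        unfolding K_def by (simp add: sum_distrib_left mult_ac)
      then show ?thesis using pe_int by simp
    qed
    have inner: "(\<integral>x. cnj (p x) * K x y \<partial>M) = (\<Sum>n\<in>I. of_real (v n) * cnj (e n y) * c n)" for y
    proof -
      have "(\<integral>x. cnj (p x) * K x y \<partial>M)
          = (\<integral>x. (\<Sum>n\<in>I. (of_real (v n) * cnj (e n y)) * (e n x * cnj (p x))) \<partial>M)"
        unfolding K_def by (simp add: sum_distrib_left mult_ac)
      also have "\<dots> = (\<Sum>n\<in>I. of_real (v n) * cnj (e n y) * c n)"
        unfolding c_def using pe_int by (subst Bochner_Integration.integral_sum) simp_all
      finally show ?thesis .
    qed
    have cnj_c: "(\<integral>y. p y * cnj (e n y) \<partial>M) = cnj (c n)" for n
      unfolding c_def by (subst Bochner_Integration.integral_cnj[symmetric]) (simp add: mult_ac)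
    have pe_int': "integrable M (\<lambda>y. p y * cnj (e n y))" for n
      using integrable_cnj[of M "\<lambda>x. e n x * cnj (p x)"] pe_int[of n] by (simp add: mult_ac)
    have "complex_of_real S = (\<Sum>n\<in>I. (of_real (v n) * c n) * cnj (c n))"
      unfolding S_def of_real_sum of_real_mult complex_norm_square by (simp add: mult_ac)
    also have "\<dots> = (\<Sum>n\<in>I. (of_real (v n) * c n) * (\<integral>y. p y * cnj (e n y) \<partial>M))"
      by (simp add: cnj_c)
    also have "\<dots> = (\<integral>y. (\<Sum>n\<in>I. (of_real (v n) * c n) * (p y * cnj (e n y))) \<partial>M)"
      using pe_int' by (subst Bochner_Integration.integral_sum) simp_all
    also have "\<dots> = (\<integral>y. p y * (\<integral>x. cnj (p x) * K x y \<partial>M) \<partial>M)"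
      unfolding inner by (simp add: sum_distrib_left mult_ac)
    finally have "ennreal S = ennreal (cmod (\<integral>y. p y * (\<integral>x. cnj (p x) * K x y \<partial>M) \<partial>M))"
      using S0 by (metis norm_of_real abs_of_nonneg)
    also have "\<dots> \<le> (\<integral>\<^sup>+ y. cmod (p y * (\<integral>x. cnj (p x) * K x y \<partial>M)) \<partial>M)"
    proof (rule integral_norm_bound_ennreal)
      have "(\<lambda>y. p y * (\<integral>x. cnj (p x) * K x y \<partial>M))
          = (\<lambda>y. \<Sum>n\<in>I. (of_real (v n) * c n) * (p y * cnj (e n y)))"
        unfolding inner by (simp add: sum_distrib_left mult_ac)
      then show "integrable M (\<lambda>y. p y * (\<integral>x. cnj (p x) * K x y \<partial>M))"
        using pe_int' by simp
    qed
    also have "\<dots> \<le> (\<integral>\<^sup>+ y. (\<integral>\<^sup>+ x. ennreal (cmod (p y)) * ennreal (cmod (p x) * cmod (K x y)) \<partial>M) \<partial>M)"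
    proof (rule nn_integral_mono)
      fix y
      have "ennreal (cmod (\<integral>x. cnj (p x) * K x y \<partial>M)) \<le> (\<integral>\<^sup>+ x. ennreal (cmod (p x) * cmod (K x y)) \<partial>M)"
        using integral_norm_bound_ennreal[OF inner_int] by (simp add: norm_mult)
      then show "ennreal (cmod (p y * (\<integral>x. cnj (p x) * K x y \<partial>M)))
          \<le> (\<integral>\<^sup>+ x. ennreal (cmod (p y)) * ennreal (cmod (p x) * cmod (K x y)) \<partial>M)"
        by (subst nn_integral_cmult) (auto simp: norm_mult ennreal_mult intro!: mult_left_mono)
    qed
    \<comment> \<open>AM-GM splits |p(x)| |p(y)|, and \<open>K_sym\<close> flips the kernel in the
      second summand. That half is then \<open>D\<close> after renaming variables, while the first
      half is \<open>D\<close> after exchanging the integrals.\<close>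
    also have "\<dots> \<le> (\<integral>\<^sup>+ y. (\<integral>\<^sup>+ x. ennreal ((cmod (p x))\<^sup>2 / 2) * ennreal (cmod (K x y))
         + ennreal ((cmod (p y))\<^sup>2 / 2) * ennreal (cmod (K y x)) \<partial>M) \<partial>M)"
    proof (intro nn_integral_mono)
      fix x y
      have "cmod (p y) * cmod (p x) \<le> (cmod (p x))\<^sup>2 / 2 + (cmod (p y))\<^sup>2 / 2"
        using sum_squares_bound[of "cmod (p x)" "cmod (p y)"] by (simp add: mult_ac)
      then have "cmod (p y) * cmod (p x) * cmod (K x y)
          \<le> ((cmod (p x))\<^sup>2 / 2 + (cmod (p y))\<^sup>2 / 2) * cmod (K x y)"
        by (rule mult_right_mono) simp
      then show "ennreal (cmod (p y)) * ennreal (cmod (p x) * cmod (K x y))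
          \<le> ennreal ((cmod (p x))\<^sup>2 / 2) * ennreal (cmod (K x y))
         + ennreal ((cmod (p y))\<^sup>2 / 2) * ennreal (cmod (K y x))"
        by (simp add: K_sym[of y x] ennreal_mult[symmetric] ennreal_plus[symmetric] algebra_simps
            del: ennreal_plus)
    qed
    also have "\<dots> = (\<integral>\<^sup>+ y. (\<integral>\<^sup>+ x. ennreal ((cmod (p x))\<^sup>2 / 2) * ennreal (cmod (K x y)) \<partial>M) \<partial>M)
         + (\<integral>\<^sup>+ y. (\<integral>\<^sup>+ x. ennreal ((cmod (p y))\<^sup>2 / 2) * ennreal (cmod (K y x)) \<partial>M) \<partial>M)"
      by (subst nn_integral_add[symmetric]) (auto intro!: nn_integral_cong nn_integral_add)
    also have "(\<integral>\<^sup>+ y. (\<integral>\<^sup>+ x. ennreal ((cmod (p x))\<^sup>2 / 2) * ennreal (cmod (K x y)) \<partial>M) \<partial>M)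
        = D"
      unfolding D_def by (rule P.Fubini') measurable
    also have "(\<integral>\<^sup>+ y. (\<integral>\<^sup>+ x. ennreal ((cmod (p y))\<^sup>2 / 2) * ennreal (cmod (K y x)) \<partial>M) \<partial>M) = D"
      by (simp add: D_def)
    also have "D + D \<le> ennreal (C * X / 2) + ennreal (C * X / 2)"
      by (intro add_mono D_le)
    also have "\<dots> = ennreal (C * X)"
      using C X0 by (subst ennreal_plus[symmetric]) auto
    finally show ?thesis using C X0 by (subst (asm) ennreal_le_iff) auto
  qed
  have "X = cmod (\<Sum>n\<in>I. a n * c n)"
    using X0 X_eq by (metis norm_of_real abs_of_nonneg)
  also have "\<dots> \<le> (\<Sum>n\<in>I. cmod (a n) * cmod (c n))"
    by (rule order.trans[OF norm_sum]) (simp add: norm_mult)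
  \<comment> \<open>Young's inequality, weighted so that \<open>S \<le> C * X\<close> turns the
    second part into at most \<open>X / 2\<close>. This is absorbed on the left, where
    \<open>X\<close> is a finite real number.\<close>
  also have "\<dots> \<le> (\<Sum>n\<in>I. C / 2 * ((cmod (a n))\<^sup>2 / v n) + 1 / (2 * C) * (v n * (cmod (c n))\<^sup>2))"
  proof (rule sum_mono)
    fix n assume "n \<in> I"
    then have vn: "0 < v n" by (rule v)
    have "0 \<le> (C * cmod (a n) - v n * cmod (c n))\<^sup>2 / (2 * C * v n)" using vn C by simp
    also have "\<dots> = C / 2 * ((cmod (a n))\<^sup>2 / v n) + 1 / (2 * C) * (v n * (cmod (c n))\<^sup>2)
        - cmod (a n) * cmod (c n)"
      using vn C by (simp add: field_simps power2_eq_square)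
    finally show "cmod (a n) * cmod (c n)
       \<le> C / 2 * ((cmod (a n))\<^sup>2 / v n) + 1 / (2 * C) * (v n * (cmod (c n))\<^sup>2)" by simp
  qed
  also have "\<dots> = C / 2 * (\<Sum>n\<in>I. (cmod (a n))\<^sup>2 / v n) + 1 / (2 * C) * S"
    by (simp add: S_def sum.distrib sum_distrib_left)
  also have "1 / (2 * C) * S \<le> X / 2" using S_le C by (simp add: field_simps)
  finally have "X \<le> C * (\<Sum>n\<in>I. (cmod (a n))\<^sup>2 / v n)" by simp
  then show ?thesis using X_nn by (simp add: p_def ennreal_leI)
qed

subsection \<open>Taylor coefficients and the Dirichlet norm\<close>

text \<open>
  The library has orthogonal invariance of Lebesgue measure only on \<open>real ^ 'n\<close>, so it is
  transported to \<open>complex\<close> along \<open>real ^ 2\<close>.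
\<close>

lemma vec2_complex_box:
  "{x::real^2. Complex (x $ 1) (x $ 2) \<in> box l u} = box (vector [Re l, Im l]) (vector [Re u, Im u])"
  by (rule set_eqI) (auto simp: in_box_complex_iff mem_box_cart forall_2)

lemma emeasure_lborel_vec2_complex:
  assumes "A \<in> sets borel"
  shows "emeasure lborel {x::real^2. Complex (x $ 1) (x $ 2) \<in> A} = emeasure lborel A"
proof -
  define h :: "real^2 \<Rightarrow> complex" where "h x = Complex (x $ 1) (x $ 2)" for x
  have h [measurable]: "h \<in> borel_measurable borel"
    unfolding h_def Complex_eq by (intro borel_measurable_continuous_onI continuous_intros)
  have "lborel = distr lborel borel h"
  proof (rule lborel_eqI)
    fix l u :: complex
    assume lu: "\<And>b. b \<in> Basis \<Longrightarrow> l \<bullet> b \<le> u \<bullet> b"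
    have "h -` box l u = box (vector [Re l, Im l]) (vector [Re u, Im u])"
      using vec2_complex_box[of l u] by (simp add: h_def vimage_def)
    then show "emeasure (distr lborel borel h) (box l u) = ennreal (\<Prod>b\<in>Basis. (u - l) \<bullet> b)"
      using lu[of 1] lu[of \<i>] by (simp add: emeasure_distr emeasure_lborel_box_eq Basis_complex_def Basis_vec_def
          axis_eq_axis inner_axis forall_2 UNIV_2)
  qed simp
  then have "emeasure lborel A = emeasure (distr lborel borel h) A" by simp
  also have "\<dots> = emeasure lborel (h -` A)"
    using assms by (subst emeasure_distr) auto
  finally show ?thesis by (simp add: h_def vimage_def)
qed

lemma lborel_complex_rotation:
  assumes u: "cmod u = 1"
  shows "distr lborel borel (\<lambda>z. u * z) = (lborel :: complex measure)"
proof (rule lborel_eqI[symmetric])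
  fix l r :: complex
  assume lr: "\<And>b. b \<in> Basis \<Longrightarrow> l \<bullet> b \<le> r \<bullet> b"
  define h :: "real^2 \<Rightarrow> complex" where "h x = Complex (x $ 1) (x $ 2)" for x
  define g :: "complex \<Rightarrow> real^2" where "g z = vector [Re z, Im z]" for z
  have hg [simp]: "h (g z) = z" for z by (simp add: h_def g_def)
  have gh [simp]: "g (h x) = x" for x by (simp add: h_def g_def vec_eq_iff forall_2)
  \<comment> \<open>\<open>cnj u\<close> is the inverse of \<open>u\<close>, since |u| = 1.\<close>
  define T where "T x = g (cnj u * h x)" for x
  have uu: "u * cnj u = 1" using u by (simp add: complex_norm_square[symmetric])
  have T_orth: "orthogonal_transformation T"
  proof -
    have "linear T"
      by (rule linearI) (auto simp: T_def g_def h_def vec_eq_iff forall_2 algebra_simps)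
    moreover have "norm (T x) = norm x" for x
    proof -
      have nh: "norm y = cmod (h y)" for y :: "real^2"
        by (simp add: h_def norm_vec_def L2_set_def cmod_def sum_2)
      show ?thesis using u by (simp add: nh T_def norm_mult)
    qed
    ultimately show ?thesis by (simp add: orthogonal_transformation)
  qed
  define A where "A = {x. h x \<in> box l r}"
  have A: "A \<in> lmeasurable" 
  proof -
    have "A = box (g l) (g r)"
      using vec2_complex_box[of l r] by (simp add: A_def h_def g_def)
    then show ?thesis by simp
  qed
  have img: "{x. h x \<in> (\<lambda>z. u * z) -` box l r} = T ` A"
  proof (intro equalityI subsetI)
    fix x assume "x \<in> {x. h x \<in> (\<lambda>z. u * z) -` box l r}"
    then have "g (u * h x) \<in> A" by (simp add: A_def)
    moreover have "x = T (g (u * h x))"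
      using uu by (simp add: T_def mult.assoc[symmetric] mult.commute[of "cnj u"])
    ultimately show "x \<in> T ` A" by blast
  next
    fix y assume "y \<in> T ` A"
    then obtain x where "x \<in> A" "y = T x" by blast
    then show "y \<in> {x. h x \<in> (\<lambda>z. u * z) -` box l r}"
      using uu by (simp add: T_def A_def mult.assoc[symmetric])
  qed
  \<comment> \<open>The facts on orthogonal images concern \<open>lebesgue\<close>; on Borel sets it
    agrees with \<open>lborel\<close>.\<close>
  have h_emeasure: "emeasure lebesgue {x. h x \<in> B} = emeasure lborel B" if "B \<in> sets borel" for B
  proof -
    have [measurable]: "h \<in> borel_measurable borel"
      unfolding h_def Complex_eq by (intro borel_measurable_continuous_onI continuous_intros)
    have "{x. h x \<in> B} \<in> sets borel"
      using measurable_sets[of h borel borel B] that by (simp add: vimage_def)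
    then show ?thesis
      using emeasure_lborel_vec2_complex[OF that] by (simp add: h_def)
  qed
  have "emeasure (distr lborel borel (\<lambda>z. u * z)) (box l r) = emeasure lborel ((\<lambda>z. u * z) -` box l r)"
    by (subst emeasure_distr) auto
  also have "\<dots> = emeasure lebesgue {x. h x \<in> (\<lambda>z. u * z) -` box l r}"
    by (rule h_emeasure[symmetric]) (auto intro!: borel_open open_vimage continuous_intros)
  also have "\<dots> = emeasure lebesgue A"
    unfolding img using measurable_orthogonal_image[OF T_orth A] measure_orthogonal_image[OF T_orth A] A
    by (simp add: emeasure_eq_measure2 fmeasurableD)
  also have "\<dots> = emeasure lborel (box l r)"
    unfolding A_def by (rule h_emeasure) simp
  finally show "emeasure (distr lborel borel (\<lambda>z. u * z)) (box l r) = ennreal (\<Prod>b\<in>Basis. (r - l) \<bullet> b)"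
    using lr by simp
qed simp

section \<open>Orthogonality and moments of monomials on disks\<close>

lemma integral_disk_monomials_orthogonal:
  assumes "n \<noteq> m"
  shows "(LINT z:ball 0 r|lborel. z ^ n * cnj z ^ m) = 0"
proof -
  \<comment> \<open>Rotating by this angle multiplies the integrand by \<open>-1\<close>.\<close>
  define a where "a = pi / (real n - real m)"
  define u where "u = cis a"
  define F where "F z = indicator (ball 0 r) z *\<^sub>R (z ^ n * cnj z ^ m)" for z :: complex
  have [measurable]: "F \<in> borel_measurable borel" 
    unfolding F_def by (intro borel_measurable_scaleR borel_measurable_indicator) (auto simp del: complex_cnj_power)
  have "u ^ n * cnj u ^ m = cis (real n * a + real m * - a)"
    by (simp only: u_def cis_cnj Complex.DeMoivre cis_mult)
  also have "real n * a + real m * - a = (real n - real m) * a" by (simp add: algebra_simps)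
  also have "\<dots> = pi" using assms by (simp add: a_def)
  finally have u: "u ^ n * cnj u ^ m = -1" by simp
  have Fu: "F (u * z) = - F z" for z
  proof -
    have "F (u * z) = (u ^ n * cnj u ^ m) * F z"
      by (simp add: F_def u_def indicator_def norm_mult power_mult_distrib scaleR_conv_of_real)
    then show ?thesis by (simp add: u)
  qed
  have "integral\<^sup>L lborel F = integral\<^sup>L (distr lborel borel (\<lambda>z. u * z)) F"
    by (simp add: lborel_complex_rotation u_def)
  also have "\<dots> = (LINT z|lborel. F (u * z))" by (rule integral_distr) auto
  also have "\<dots> = - integral\<^sup>L lborel F" by (simp add: Fu)
  finally have "integral\<^sup>L lborel F = 0" by simp
  then show ?thesis by (simp add: F_def[abs_def] set_lebesgue_integral_def)
qed

lemma set_integrable_disk_monomials: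
  "set_integrable lborel (ball 0 r) (\<lambda>z::complex. z ^ n * cnj z ^ m)"
  unfolding set_integrable_def
proof (rule integrableI_bounded_set_indicator[where B = "r ^ n * r ^ m"])
  show "AE z in lborel. z \<in> ball 0 r \<longrightarrow> cmod (z ^ n * cnj z ^ m) \<le> r ^ n * r ^ m"
    by (auto simp: norm_mult norm_power intro!: AE_I2 mult_mono power_mono zero_le_power
        intro: order.trans[OF norm_ge_zero less_imp_le])
qed (auto simp: emeasure_lborel_ball_finite[unfolded infinity_ennreal_def])

text \<open>Parseval's identity for polynomials on a disk: after expanding the square, only the
  diagonal terms survive.\<close>

lemma integral_disk_polynomial_norm_sq:
  "(LINT z:ball 0 r|lborel. (cmod (\<Sum>n<K. b n * z ^ n))\<^sup>2)
     = (\<Sum>n<K. (cmod (b n))\<^sup>2 * (LINT z:ball 0 r|lborel. cmod z ^ (2 * n)))"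
proof -
  let ?B = "ball (0::complex) r"
  have diag: "(LINT z:?B|lborel. z ^ n * cnj z ^ n) = of_real (LINT z:?B|lborel. cmod z ^ (2 * n))" for n
  proof -
    have "z ^ n * cnj z ^ n = of_real (cmod z ^ (2 * n))" for z
      by (metis complex_norm_square power_mult power_mult_distrib of_real_power)
    then show ?thesis unfolding set_lebesgue_integral_def
      by (simp add: scaleR_conv_of_real of_real_mult[symmetric] del: of_real_mult of_real_power)
  qed
  have "complex_of_real (LINT z:?B|lborel. (cmod (\<Sum>n<K. b n * z ^ n))\<^sup>2)
      = (LINT z:?B|lborel. of_real ((cmod (\<Sum>n<K. b n * z ^ n))\<^sup>2))"
    unfolding set_lebesgue_integral_def
    by (simp add: scaleR_conv_of_real of_real_mult[symmetric] del: of_real_mult of_real_power)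
  also have "\<dots> = (LINT z:?B|lborel. (\<Sum>n<K. \<Sum>m<K. (b n * cnj (b m)) * (z ^ n * cnj z ^ m)))"
    unfolding complex_norm_square
    by (simp add: sum_product mult_ac)
  also have "\<dots> = (\<Sum>n<K. \<Sum>m<K. (b n * cnj (b m)) * (LINT z:?B|lborel. z ^ n * cnj z ^ m))"
  proof -
    define q where "q n m z = indicator ?B z *\<^sub>R (z ^ n * cnj z ^ m)" for n m z
    have q: "integrable lborel (q n m)" for n m
      using set_integrable_disk_monomials[of r n m] by (simp add: q_def[abs_def] set_integrable_def)
    have "(LINT z|lborel. (\<Sum>n<K. \<Sum>m<K. (b n * cnj (b m)) * q n m z))
        = (\<Sum>n<K. \<Sum>m<K. (b n * cnj (b m)) * integral\<^sup>L lborel (q n m))"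
      using q by simp
    then show ?thesis
      by (simp only: set_lebesgue_integral_def q_def[abs_def] scaleR_sum_right mult_scaleR_right)
  qed
  also have "\<dots> = (\<Sum>n<K. \<Sum>m<K. if m = n then (b n * cnj (b n)) * (LINT z:?B|lborel. z ^ n * cnj z ^ n) else 0)"
    by (intro sum.cong refl) (auto simp: integral_disk_monomials_orthogonal)
  also have "\<dots> = (\<Sum>n<K. (b n * cnj (b n)) * of_real (LINT z:?B|lborel. cmod z ^ (2 * n)))"
    by (simp add: diag)
  also have "\<dots> = of_real (\<Sum>n<K. (cmod (b n))\<^sup>2 * (LINT z:?B|lborel. cmod z ^ (2 * n)))"
    by (simp only: of_real_sum of_real_mult complex_norm_square)
  finally show ?thesis by (simp only: of_real_eq_iff)
qed

lemma power_series_coeff_le_disk_integral: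
  assumes g: "\<And>z. z \<in> ball 0 1 \<Longrightarrow> (\<lambda>n. b n * z ^ n) sums g z" and r: "0 < r" "r < 1"
  shows "ennreal (\<Sum>n<N. (cmod (b n))\<^sup>2 * (LINT z:ball 0 r|lborel. cmod z ^ (2 * n)))
     \<le> (\<integral>\<^sup>+ z\<in>ball 0 r. ennreal ((cmod (g z))\<^sup>2) \<partial>lborel)"
proof -
  let ?B = "ball (0::complex) r"
  define s where "s K z = indicator ?B z *\<^sub>R (cmod (\<Sum>n<K. b n * z ^ n))\<^sup>2" for K z
  define G where "G z = indicator ?B z *\<^sub>R (cmod (g z))\<^sup>2" for z
  have s_meas [measurable]: "s K \<in> borel_measurable lborel" for K
    unfolding s_def by (intro borel_measurable_scaleR borel_measurable_indicator) auto
  have lim: "(\<lambda>K. s K z) \<longlonglongrightarrow> G z" for z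
  proof (cases "z \<in> ?B")
    case True
    then have "(\<lambda>K. \<Sum>n<K. b n * z ^ n) \<longlonglongrightarrow> g z" using g[of z] r by (simp add: sums_def)
    then show ?thesis unfolding s_def G_def by (intro tendsto_intros)
  qed (simp add: s_def G_def)
  have G_meas [measurable]: "G \<in> borel_measurable lborel"
    by (rule borel_measurable_LIMSEQ_real[OF lim s_meas])
  define L where "L = (\<Sum>n. cmod (b n) * r ^ n)"
  have L_summable: "summable (\<lambda>n. cmod (b n) * r ^ n)"
  proof -
    \<comment> \<open>Convergence at a point strictly between \<open>r\<close> and 1 gives absolute
      convergence at \<open>r\<close>.\<close>
    have "summable (\<lambda>n. b n * of_real ((1 + r) / 2) ^ n)"
      using g[of "of_real ((1 + r) / 2)"] r by (auto simp: sums_iff norm_divide simp flip: of_real_add)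
    from powser_insidea[OF this, of "of_real r"] show ?thesis
      using r by (simp add: norm_mult norm_power norm_divide flip: of_real_add)
  qed
  define w where "w z = indicator ?B z *\<^sub>R L\<^sup>2" for z :: complex
  have w: "integrable lborel w" unfolding w_def
    by (rule integrableI_bounded_set_indicator[where B = "L\<^sup>2"]) (auto simp: emeasure_lborel_ball_finite[unfolded infinity_ennreal_def])
  have bound: "norm (s K z) \<le> w z" for K z
  proof (cases "z \<in> ?B")
    case True
    have "cmod (\<Sum>n<K. b n * z ^ n) \<le> (\<Sum>n<K. cmod (b n) * r ^ n)"
      using True by (intro order.trans[OF norm_sum] sum_mono)
        (auto simp: norm_mult norm_power intro!: mult_left_mono power_mono)
    also have "\<dots> \<le> L" unfolding L_def using r by (intro sum_le_suminf L_summable) auto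
    finally show ?thesis using True by (simp add: s_def w_def power_mono)
  qed (simp add: s_def w_def)
  have int_lim: "(\<lambda>K. integral\<^sup>L lborel (s K)) \<longlonglongrightarrow> integral\<^sup>L lborel G"
    by (rule integral_dominated_convergence[OF G_meas s_meas w]) (use lim bound in auto)
  have G_int: "integrable lborel G"
    by (rule integrable_dominated_convergence[where s = s, OF G_meas s_meas w]) (use lim bound in auto)
  have m0: "0 \<le> (LINT z:?B|lborel. cmod z ^ (2 * n))" for n
    unfolding set_lebesgue_integral_def by (intro integral_nonneg_AE AE_I2) auto
  have "(\<Sum>n<N. (cmod (b n))\<^sup>2 * (LINT z:?B|lborel. cmod z ^ (2 * n))) \<le> integral\<^sup>L lborel G"
  proof (rule LIMSEQ_le_const[OF int_lim], intro exI allI impI)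
    fix K assume "N \<le> K"
    then have "(\<Sum>n<N. (cmod (b n))\<^sup>2 * (LINT z:?B|lborel. cmod z ^ (2 * n)))
        \<le> (\<Sum>n<K. (cmod (b n))\<^sup>2 * (LINT z:?B|lborel. cmod z ^ (2 * n)))"
      using m0 by (intro sum_mono2) auto
    also have "\<dots> = integral\<^sup>L lborel (s K)"
      using integral_disk_polynomial_norm_sq[of r b K, unfolded set_lebesgue_integral_def]
      by (simp only: s_def[abs_def] set_lebesgue_integral_def)
    finally show "(\<Sum>n<N. (cmod (b n))\<^sup>2 * (LINT z:?B|lborel. cmod z ^ (2 * n))) \<le> integral\<^sup>L lborel (s K)" .
  qed
  then have "ennreal (\<Sum>n<N. (cmod (b n))\<^sup>2 * (LINT z:?B|lborel. cmod z ^ (2 * n))) \<le> ennreal (integral\<^sup>L lborel G)"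
    by (rule ennreal_leI)
  also have "\<dots> = (\<integral>\<^sup>+ z. ennreal (G z) \<partial>lborel)"
    by (rule nn_integral_eq_integral[symmetric, OF G_int]) (simp add: G_def)
  also have "\<dots> = (\<integral>\<^sup>+ z\<in>?B. ennreal ((cmod (g z))\<^sup>2) \<partial>lborel)"
    by (intro nn_integral_cong) (simp add: G_def indicator_def)
  finally show ?thesis .
qed

text \<open>The exact moment is pi r^(2n+2) / (n+1). An annulus near the boundary already gives this
  order: the integrand is at least 1/4 there and the area at least pi / (4(n+1)), whence 16.\<close>

lemma integral_disk_norm_power_ge:
  assumes r: "1 - 1 / (4 * real (Suc n)) \<le> r" "r < 1"
  shows "pi / (16 * real (Suc n)) \<le> (LINT z:ball (0::complex) r|lborel. cmod z ^ (2 * n))"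
proof -
  \<comment> \<open>By Bernoulli, \<open>\<rho> ^ n\<close> is at least 1 - n / (2(n+1)), hence at
    least 1/2, while \<open>r - \<rho>\<close> keeps the size 1 / (4(n+1)).\<close>
  define \<rho> where "\<rho> = 1 - 1 / (2 * real (Suc n))"
  let ?A = "ball (0::complex) r - ball 0 \<rho>"
  have rho: "1 / 2 \<le> \<rho>" by (simp add: \<rho>_def field_simps)
  have gap: "1 / (4 * real (Suc n)) \<le> r - \<rho>"
  proof -
    define x where "x = 1 / (4 * real (Suc n))"
    have "\<rho> = 1 - 2 * x" by (simp add: \<rho>_def x_def field_simps)
    moreover have "1 - x \<le> r" using r by (simp add: x_def)
    ultimately have "x \<le> r - \<rho>" by linarith
    then show ?thesis by (simp only: x_def)
  qed
  then have rho_r: "\<rho> < r"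
    by (smt (verit) divide_pos_pos of_nat_0_less_iff zero_less_Suc)
  have pow: "1 / 4 \<le> cmod z ^ (2 * n)" if "z \<in> ?A" for z
  proof -
    have "1 / 2 \<le> 1 + real n * (- 1 / (2 * real (Suc n)))" by (simp add: field_simps)
    also have "\<dots> \<le> (1 + (- 1 / (2 * real (Suc n)))) ^ n"
      by (rule Bernoulli_inequality) (simp add: field_simps)
    also have "\<dots> = \<rho> ^ n" by (simp add: \<rho>_def)
    also have "\<dots> \<le> cmod z ^ n" using that rho by (intro power_mono) auto
    finally have "(1 / 2)\<^sup>2 \<le> (cmod z ^ n)\<^sup>2" by (intro power_mono) auto
    then show ?thesis by (simp add: power_even_eq power_divide)
  qed
  have "measure lborel ?A = measure lborel (ball (0::complex) r) - measure lborel (ball (0::complex) \<rho>)"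
    using rho_r emeasure_lborel_ball_finite[of "0::complex" r] by (intro measure_Diff) auto
  also have "\<dots> = pi * (r\<^sup>2 - \<rho>\<^sup>2)"
    using rho rho_r by (simp add: content_ball unit_ball_vol_2 algebra_simps)
  also have "\<dots> = pi * ((r - \<rho>) * (r + \<rho>))" by (simp add: power2_eq_square algebra_simps)
  finally have area: "measure lborel ?A = pi * ((r - \<rho>) * (r + \<rho>))" .
  have "1 / (4 * real (Suc n)) * 1 \<le> (r - \<rho>) * (r + \<rho>)"
    using gap rho rho_r by (intro mult_mono) auto
  then have "pi * (1 / (4 * real (Suc n)) * 1) \<le> measure lborel ?A"
    unfolding area by (intro mult_left_mono) auto
  then have "pi / (16 * real (Suc n)) \<le> measure lborel ?A * (1 / 4)" by (simp add: field_simps)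
  also have "\<dots> = (LINT z|lborel. indicator ?A z *\<^sub>R (1 / 4))" 
    by simp
  also have "\<dots> \<le> (LINT z|lborel. indicator (ball (0::complex) r) z *\<^sub>R cmod z ^ (2 * n))"
  proof (rule integral_mono)
    show "integrable lborel (\<lambda>z. indicator ?A z *\<^sub>R (1 / 4 :: real))"
      using emeasure_lborel_ball_finite[of "0::complex" r]
      by (intro integrableI_bounded_set_indicator[where B = 1]) (auto intro: le_less_trans[OF emeasure_mono])
    show "integrable lborel (\<lambda>z. indicator (ball (0::complex) r) z *\<^sub>R cmod z ^ (2 * n))"
      using r by (intro integrableI_bounded_set_indicator[where B = 1])
        (auto simp: emeasure_lborel_ball_finite[unfolded infinity_ennreal_def] power_le_one)
    show "indicator ?A z *\<^sub>R (1 / 4) \<le> indicator (ball (0::complex) r) z *\<^sub>R cmod z ^ (2 * n)" for z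
      using pow[of z] by (auto simp: indicator_def)
  qed
  finally show ?thesis by (simp add: set_lebesgue_integral_def)
qed

text \<open>The coefficients of \<open>deriv f\<close> are (n+1) a_(n+1), and the moment contributes
  about 1 / (n+1), so one factor n+1 remains. The 16 stems from the crude moment bound. Finite sums
  avoid any question of summability.\<close>

lemma dirichlet_norm_sq_ge_coeffs:
  assumes f: "f holomorphic_on unit_disk"
  defines "a \<equiv> \<lambda>n. (deriv ^^ n) f 0 / fact n"
  shows "ennreal ((cmod (a 0))\<^sup>2 + (\<Sum>n=1..N. real n * (cmod (a n))\<^sup>2)) \<le> 16 * dirichlet_norm_sq f"
proof -
  define b where "b n = (deriv ^^ n) (deriv f) 0 / fact n" for n
  have b: "b n = of_nat (Suc n) * a (Suc n)" for n
    unfolding a_def b_def by (simp add: funpow_swap1 field_simps del: of_nat_Suc)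
  \<comment> \<open>A single radius that is close enough to 1 for all of the first \<open>N\<close> moments.\<close>
  define r where "r = 1 - 1 / (4 * real (Suc N))"
  have r: "0 < r" "r < 1" by (auto simp: r_def field_simps)
  have sums: "(\<lambda>n. b n * z ^ n) sums deriv f z" if "z \<in> ball 0 1" for z
    using holomorphic_power_series[OF holomorphic_deriv[OF f open_ball] that] by (simp add: b_def)
  have "(\<Sum>n=1..N. real n * (cmod (a n))\<^sup>2) = (\<Sum>n<N. real (Suc n) * (cmod (a (Suc n)))\<^sup>2)"
    by (rule sum.reindex_bij_witness[of _ Suc "\<lambda>n. n - 1"]) auto
  also have "\<dots> \<le> (\<Sum>n<N. 16 / pi * ((cmod (b n))\<^sup>2 * (LINT z:ball 0 r|lborel. cmod z ^ (2 * n))))"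
  proof (rule sum_mono)
    fix n assume "n \<in> {..<N}"
    then have "1 - 1 / (4 * real (Suc n)) \<le> r" by (simp add: r_def field_simps)
    then have "pi / (16 * real (Suc n)) \<le> (LINT z:ball (0::complex) r|lborel. cmod z ^ (2 * n))"
      using r by (intro integral_disk_norm_power_ge)
    then have "16 / pi * ((cmod (b n))\<^sup>2 * (pi / (16 * real (Suc n))))
        \<le> 16 / pi * ((cmod (b n))\<^sup>2 * (LINT z:ball 0 r|lborel. cmod z ^ (2 * n)))"
      by (intro mult_left_mono) auto
    moreover have "16 / pi * ((cmod (b n))\<^sup>2 * (pi / (16 * real (Suc n)))) = real (Suc n) * (cmod (a (Suc n)))\<^sup>2"
      unfolding b norm_mult power_mult_distrib norm_of_nat by (simp add: power2_eq_square del: of_nat_Suc)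
    ultimately show "real (Suc n) * (cmod (a (Suc n)))\<^sup>2
        \<le> 16 / pi * ((cmod (b n))\<^sup>2 * (LINT z:ball 0 r|lborel. cmod z ^ (2 * n)))" by simp
  qed
  finally have le: "(\<Sum>n=1..N. real n * (cmod (a n))\<^sup>2)
      \<le> 16 / pi * (\<Sum>n<N. (cmod (b n))\<^sup>2 * (LINT z:ball 0 r|lborel. cmod z ^ (2 * n)))"
    by (simp only: sum_distrib_left)
  have "ennreal (\<Sum>n=1..N. real n * (cmod (a n))\<^sup>2)
      \<le> ennreal (16 / pi) * ennreal (\<Sum>n<N. (cmod (b n))\<^sup>2 * (LINT z:ball 0 r|lborel. cmod z ^ (2 * n)))"
    using ennreal_leI[OF le] by (subst ennreal_mult'[symmetric]) auto
  also have "\<dots> \<le> ennreal (16 / pi) * (\<integral>\<^sup>+ z\<in>ball 0 r. ennreal ((cmod (deriv f z))\<^sup>2) \<partial>lborel)"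
    by (intro mult_left_mono power_series_coeff_le_disk_integral[OF sums r]) auto
  also have "\<dots> \<le> ennreal (16 / pi) * (\<integral>\<^sup>+ z\<in>unit_disk. ennreal ((cmod (deriv f z))\<^sup>2) \<partial>lborel)"
    using r by (intro mult_left_mono nn_integral_mono) (auto simp: indicator_def)
  also have "\<dots> = 16 * (ennreal (1 / pi) * (\<integral>\<^sup>+ z\<in>unit_disk. ennreal ((cmod (deriv f z))\<^sup>2) \<partial>lborel))"
  proof -
    have "ennreal (16 / pi) = 16 * ennreal (1 / pi)"
      using ennreal_mult'[of 16 "1 / pi"] by simp
    then show ?thesis by (simp add: mult.assoc)
  qed
  finally have 1: "ennreal (\<Sum>n=1..N. real n * (cmod (a n))\<^sup>2)
     \<le> 16 * (ennreal (1 / pi) * (\<integral>\<^sup>+ z\<in>unit_disk. ennreal ((cmod (deriv f z))\<^sup>2) \<partial>lborel))" .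
  have 2: "ennreal ((cmod (a 0))\<^sup>2) \<le> 16 * ennreal ((cmod (f 0))\<^sup>2)"
  proof -
    have "ennreal ((cmod (a 0))\<^sup>2) \<le> ennreal (16 * (cmod (f 0))\<^sup>2)"
      by (intro ennreal_leI) (simp add: a_def)
    then show ?thesis by (simp add: ennreal_mult)
  qed
  have "ennreal ((cmod (a 0))\<^sup>2 + (\<Sum>n=1..N. real n * (cmod (a n))\<^sup>2))
      = ennreal ((cmod (a 0))\<^sup>2) + ennreal (\<Sum>n=1..N. real n * (cmod (a n))\<^sup>2)"
    by (intro ennreal_plus sum_nonneg) auto
  also have "\<dots> \<le> 16 * dirichlet_norm_sq f"
    unfolding dirichlet_norm_sq_def distrib_left by (rule add_mono[OF 2 1])
  finally show ?thesis .
qed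

text \<open>
  The series on the right counts the scales \<open>1 / 4 ^ k\<close> exceeding \<open>cmod (z - w)\<close>; it stands in
  for \<open>log (1 / cmod (z - w))\<close> and integrates directly to masses of balls.
\<close>

lemma log_partial_sum_bound_indicator:
  assumes z: "z \<in> unit_disk" and w: "w \<in> unit_disk"
  shows "ennreal (cmod (\<Sum>n=1..N. (z * cnj w) ^ n / of_nat n))
    \<le> 3 + 3 * (\<Sum>k. indicator (disk_ball z (1 / 4 ^ k)) w)"
proof -
  define x where "x = z * cnj w"
  have x: "cmod x < 1"
    using mult_strict_mono'[of "cmod z" 1 "cmod w" 1] z w by (simp add: x_def norm_mult)
  then have pos: "0 < cmod (1 - x)" by auto
  \<comment> \<open>By minimality every \<open>k < j\<close> has |z - w| <= |1 - x| < 1 / 4^k, so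
    \<open>w\<close> lies in at least \<open>j\<close> of the balls, and the series of indicators
    dominates \<open>j\<close>.\<close>
  define j where "j = (LEAST k. 1 \<le> 4 ^ k * cmod (1 - x))"
  obtain k0 where "1 / cmod (1 - x) < 4 ^ k0"
    using real_arch_pow[of 4 "1 / cmod (1 - x)"] by auto
  then have "1 \<le> 4 ^ k0 * cmod (1 - x)" using pos by (simp add: field_simps)
  then have j: "1 \<le> 4 ^ j * cmod (1 - x)" unfolding j_def by (rule LeastI)
  have in_ball: "w \<in> disk_ball z (1 / 4 ^ k)" if "k < j" for k
  proof -
    have "\<not> 1 \<le> 4 ^ k * cmod (1 - x)" using not_less_Least[of k] that unfolding j_def by blast
    then have "cmod (1 - x) < 1 / 4 ^ k" by (simp add: field_simps)
    moreover have "cmod (z - w) \<le> cmod (1 - x)"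
      unfolding x_def using z w by (intro cmod_diff_le_one_minus_mult_cnj) auto
    ultimately show ?thesis using w by (simp add: disk_ball_def)
  qed
  have "ennreal (cmod (\<Sum>n=1..N. x ^ n / of_nat n)) \<le> ennreal (3 + 3 * real j)"
    using x j by (intro ennreal_leI log_partial_sum_bound) auto
  also have "\<dots> = 3 + 3 * of_nat j"
    by (simp add: ennreal_mult ennreal_of_nat_eq_real_of_nat)
  also have "of_nat j = (\<Sum>k<j. indicator (disk_ball z (1 / 4 ^ k)) w :: ennreal)"
    using in_ball by simp
  also have "\<dots> \<le> (\<Sum>k. indicator (disk_ball z (1 / 4 ^ k)) w)"
    by (rule sum_le_suminf) auto
  finally show ?thesis by (simp add: x_def add_left_mono mult_left_mono)
qed

subsection \<open>The Carleson inequality\<close>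

theorem mainTheorem2:
  fixes \<mu> :: "complex measure"
  assumes "sets \<mu> = sets disk_lborel"
    and "finite_measure \<mu>"
    and "absolutely_continuous disk_lborel \<mu>"
    and "doubling_measure \<mu>"
  shows "dirichlet_carleson_measure \<mu>"
proof -
  interpret finite_measure \<mu> by fact
  have space: "space \<mu> = unit_disk"
    using sets_eq_imp_space_eq[OF assms(1)] by (simp add: disk_lborel_def space_restrict_space)
  have ball_sets [measurable]: "disk_ball z r \<in> sets \<mu>" for z r
    unfolding disk_ball_eq assms(1) disk_lborel_def by (auto simp: sets_restrict_space)
  have meas: "g \<in> borel_measurable \<mu>" if "g \<in> borel_measurable borel" for g :: "complex \<Rightarrow> complex"
  proof -
    have "g \<in> borel_measurable disk_lborel"
      unfolding disk_lborel_def using that by (intro measurable_restrict_space1) simp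
    then show ?thesis using measurable_cong_sets[OF assms(1) refl] by blast
  qed
  have [measurable]: "(\<lambda>z. z ^ n) \<in> borel_measurable \<mu>" for n by (rule meas) simp
  obtain \<theta> :: real where th: "0 \<le> \<theta>" "\<theta> < 1" and decay: "\<And>z k. z \<in> unit_disk \<Longrightarrow>
       measure \<mu> (disk_ball z (1 / 4 ^ k)) \<le> \<theta> ^ k * measure \<mu> unit_disk"
    using doubling_measure_ball_decay[OF assms(1,2,4)] by metis
  define m where "m = measure \<mu> unit_disk"
  \<comment> \<open>\<open>4 * m\<close> integrates the constant part of the kernel bound and
    \<open>m / (1 - \<theta>)\<close> sums the masses of the balls; the final 1 keeps
    \<open>C\<close> positive when \<open>m = 0\<close>.\<close>
  define C where "C = 4 * m + 3 * (m / (1 - \<theta>)) + 1"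
  have m0: "0 \<le> m" by (simp add: m_def)
  have C0: "0 < C" using m0 th by (simp add: C_def add_nonneg_pos)
  \<comment> \<open>These weights make the kernel 1 plus the logarithmic series, and their
    reciprocals are the weights of the coefficient norm. Index 0 is separate because
    \<open>1 / 0 = 0\<close> would violate positivity.\<close>
  define v where "v n = (if n = 0 then 1 else 1 / real n)" for n
  have kernel: "(\<integral>\<^sup>+ w. ennreal (cmod (\<Sum>n\<le>N. of_real (v n) * z ^ n * cnj (w ^ n))) \<partial>\<mu>) \<le> ennreal C"
    if z: "z \<in> unit_disk" for z N
  proof -
    have "(\<integral>\<^sup>+ w. ennreal (cmod (\<Sum>n\<le>N. of_real (v n) * z ^ n * cnj (w ^ n))) \<partial>\<mu>)
        \<le> (\<integral>\<^sup>+ w. 4 + 3 * (\<Sum>k. indicator (disk_ball z (1 / 4 ^ k)) w) \<partial>\<mu>)"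
    proof (rule nn_integral_mono)
      fix w assume "w \<in> space \<mu>"
      then have w: "w \<in> unit_disk" by (simp add: space)
      have "{..N} = insert 0 {1..N}" by auto
      then have "(\<Sum>n\<le>N. of_real (v n) * z ^ n * cnj (w ^ n))
          = 1 + (\<Sum>n=1..N. of_real (v n) * z ^ n * cnj (w ^ n))"
        by (simp add: v_def)
      also have "(\<Sum>n=1..N. of_real (v n) * z ^ n * cnj (w ^ n)) = (\<Sum>n=1..N. (z * cnj w) ^ n / of_nat n)"
        by (intro sum.cong) (auto simp: v_def power_mult_distrib)
      finally have "cmod (\<Sum>n\<le>N. of_real (v n) * z ^ n * cnj (w ^ n))
          \<le> 1 + cmod (\<Sum>n=1..N. (z * cnj w) ^ n / of_nat n)"
        using norm_triangle_ineq[of 1 "\<Sum>n=1..N. (z * cnj w) ^ n / of_nat n"] by simp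
      then have "ennreal (cmod (\<Sum>n\<le>N. of_real (v n) * z ^ n * cnj (w ^ n)))
          \<le> 1 + ennreal (cmod (\<Sum>n=1..N. (z * cnj w) ^ n / of_nat n))"
        using ennreal_leI by (fastforce simp flip: ennreal_1 ennreal_plus)
      also have "\<dots> \<le> 1 + (3 + 3 * (\<Sum>k. indicator (disk_ball z (1 / 4 ^ k)) w))"
        by (intro add_left_mono log_partial_sum_bound_indicator z w)
      finally show "ennreal (cmod (\<Sum>n\<le>N. of_real (v n) * z ^ n * cnj (w ^ n)))
          \<le> 4 + 3 * (\<Sum>k. indicator (disk_ball z (1 / 4 ^ k)) w)"
        by (simp add: add.assoc[symmetric])
    qed
    also have "\<dots> = 4 * emeasure \<mu> unit_disk + 3 * (\<Sum>k. emeasure \<mu> (disk_ball z (1 / 4 ^ k)))"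
      by (simp add: nn_integral_add nn_integral_cmult nn_integral_suminf space)
    also have "\<dots> \<le> 4 * ennreal m + 3 * (\<Sum>k. ennreal (\<theta> ^ k * m))"
      using decay[OF z] unfolding m_def
      by (intro add_mono mult_left_mono suminf_le) (auto simp: emeasure_eq_measure intro!: ennreal_leI)
    also have "(\<Sum>k. ennreal (\<theta> ^ k * m)) = ennreal (m / (1 - \<theta>))"
    proof (rule suminf_ennreal_eq)
      show "(\<lambda>k. \<theta> ^ k * m) sums (m / (1 - \<theta>))"
        using sums_mult2[OF geometric_sums, of \<theta> m] th by simp
    qed (use th m0 in auto)
    also have "4 * ennreal m + 3 * ennreal (m / (1 - \<theta>)) = ennreal (4 * m + 3 * (m / (1 - \<theta>)))"
      using th m0 ennreal_mult'[of 4 m] ennreal_mult'[of 3 "m / (1 - \<theta>)"]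
      by (simp del: times_divide_eq_right)
    also have "\<dots> \<le> ennreal C" by (intro ennreal_leI) (simp add: C_def)
    finally show ?thesis .
  qed
  have poly: "(\<integral>\<^sup>+ z. ennreal ((cmod (\<Sum>n\<le>N. a n * z ^ n))\<^sup>2) \<partial>\<mu>)
      \<le> ennreal (C * ((cmod (a 0))\<^sup>2 + (\<Sum>n=1..N. real n * (cmod (a n))\<^sup>2)))" for a N
  proof -
    have "{..N} = insert 0 {1..N}" by auto
    then have "(\<Sum>n\<le>N. (cmod (a n))\<^sup>2 / v n) = (cmod (a 0))\<^sup>2 + (\<Sum>n=1..N. real n * (cmod (a n))\<^sup>2)"
      by (simp add: v_def mult.commute)
    moreover have "(\<integral>\<^sup>+ z. ennreal ((cmod (\<Sum>n\<le>N. a n * z ^ n))\<^sup>2) \<partial>\<mu>)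
        \<le> ennreal (C * (\<Sum>n\<le>N. (cmod (a n))\<^sup>2 / v n))"
      using kernel C0 finite_measure_axioms
      by (intro finite_rank_schur_test) (auto simp: space v_def norm_power intro!: power_le_one)
    ultimately show ?thesis by simp
  qed
  have "(\<integral>\<^sup>+ z. ennreal ((cmod (f z))\<^sup>2) \<partial>\<mu>) \<le> ennreal (16 * C) * dirichlet_norm_sq f"
    if "f \<in> dirichlet_space" for f
  proof -
    have f: "f holomorphic_on unit_disk" using that by (simp add: dirichlet_space_def)
    define a where "a n = (deriv ^^ n) f 0 / fact n" for n
    have lim: "(\<lambda>N. ennreal ((cmod (\<Sum>n\<le>N. a n * z ^ n))\<^sup>2)) \<longlonglongrightarrow> ennreal ((cmod (f z))\<^sup>2)"
      if "z \<in> unit_disk" for z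
      using holomorphic_power_series[OF f that] unfolding sums_def_le a_def
      by (intro tendsto_intros) simp
    have "(\<integral>\<^sup>+ z. ennreal ((cmod (f z))\<^sup>2) \<partial>\<mu>)
        = (\<integral>\<^sup>+ z. liminf (\<lambda>N. ennreal ((cmod (\<Sum>n\<le>N. a n * z ^ n))\<^sup>2)) \<partial>\<mu>)"
      using lim by (intro nn_integral_cong lim_imp_Liminf[symmetric]) (simp_all add: space)
    \<comment> \<open>Fatou's lemma suffices, since the bound for the Taylor polynomials is the same
      for every \<open>N\<close>.\<close>
    also have "\<dots> \<le> liminf (\<lambda>N. \<integral>\<^sup>+ z. ennreal ((cmod (\<Sum>n\<le>N. a n * z ^ n))\<^sup>2) \<partial>\<mu>)"
      by (rule nn_integral_liminf) measurable
    also have "\<dots> \<le> ennreal (16 * C) * dirichlet_norm_sq f"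
    proof (intro Liminf_le always_eventually allI)
      fix N
      have "(\<integral>\<^sup>+ z. ennreal ((cmod (\<Sum>n\<le>N. a n * z ^ n))\<^sup>2) \<partial>\<mu>)
          \<le> ennreal C * ennreal ((cmod (a 0))\<^sup>2 + (\<Sum>n=1..N. real n * (cmod (a n))\<^sup>2))"
        using poly[of a N] C0 by (simp add: ennreal_mult')
      also have "\<dots> \<le> ennreal C * (16 * dirichlet_norm_sq f)"
        unfolding a_def by (intro mult_left_mono dirichlet_norm_sq_ge_coeffs f) auto
      also have "\<dots> = ennreal (16 * C) * dirichlet_norm_sq f"
        using C0 by (simp add: ennreal_mult mult_ac)
      finally show "(\<integral>\<^sup>+ z. ennreal ((cmod (\<Sum>n\<le>N. a n * z ^ n))\<^sup>2) \<partial>\<mu>)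
          \<le> ennreal (16 * C) * dirichlet_norm_sq f" .
    qed simp
    finally show ?thesis .
  qed
  then show ?thesis unfolding dirichlet_carleson_measure_def by blast
qed

end
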